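(* Assume (A0), (A1) and (A2), let $(v^k)$ be the sequence generated by the iterative algorithm, and suppose $v^k\to v^*\in\mathbb R^G$. Let $\partial I^*=\{Lv^*+f=Mv^*-v^*\}\cap G_{<0}$. Consider the discrete system of QVIs $$(\ast)\qquad\begin{cases} Hv-v=0 & \text{on } -\{Mv-v=0\},\\ \max\{Lv+f,\ Mv-v\}=0 & \text{on } -\{Mv-v<0\}.\end{cases}$$ Then: (i) If the convergence is exact (i.e. attained in finitely many iterations), then $v^*$ solves $(\ast)$. (ii) If $v^*$ has the (discrete) unique impulse property and $Lv^*+f=Hv^*-v^*$ on $-\partial I^*$, then $v^*$ solves $(\ast)$.
   Context: Grid and operators. $G$ is a symmetric grid $x_{-N}=-x_N<\dots<x_{-1}=-x_1<x_0=0<x_1<\dots<x_N$ of real numbers; $\mathbb R^G$ is the set of functions $G\to\mathbb R$ (vectors), linear operators on $\mathbb R^G$ are identified with matrices in $\mathbb R^{G\times G}$, and orders, max, argmax are pointwise (elementwise). $S$ is the symmetry operator $Sv(x)=v(-x)$. $G_{<0}$ is the set of negative grid points; complements are taken in $G$. $f\in\mathbb R^G$ and $L:\mathbb R^G\to\mathbb R^G$ is linear. For each $x\in G$, $Z(x)\subseteq\mathbb R$ is a finite nonempty set, with $Z(x)=\{0\}$ if $x\ge0$; $Z=\prod_{x\in G}Z(x)$. For each $\delta\in Z$ there are given a linear $B(\delta):\mathbb R^G\to\mathbb R^G$, $c(\delta)\in(0,+\infty)^G$ and a vector $g(S\delta)\in\mathbb R^G$; these are row-decoupled: row $x$ of $B(\delta)$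 and $c(\delta)$ depends only on $\delta(x)$, and entry $x$ of $g(S\delta)$ depends only on $(S\delta)(x)=\delta(-x)$. Define $Mv=\max_{\delta\in Z}\{B(\delta)v-c(\delta)\}$, $\delta^*(v)=\max(\operatorname{argmax}_{\delta\in Z}\{B(\delta)v-c(\delta)\})$ (pointwise largest maximizer), $H(\delta)v=SB(\delta)Sv+g(S\delta)$ and $Hv=H(\delta^*(v))v$. Strategies. $\Phi=\{\varphi=(I,\delta): I\subseteq G_{<0},\ \delta\in Z\}$. Algorithm (run indefinitely, with the single-player problems solved exactly). Choose $v^0\in\mathbb R^G$, set $I^0=\{Lv^0+f\le Mv^0-v^0\}\cap G_{<0}$ and $\delta^0=\delta^*(v^0)$. For $k=0,1,\dots$: let $v^{k+1/2}=H(\delta^k)v^k$ on $-I^k$ and $v^{k+1/2}=v^k$ on $(-I^k)^c$; with $D=(-I^k)^c$, let $v^{k+1}\in\mathbb R^G$ be the (unique) solution of $\max\{Lv+f,Mv-v\}=0$ on $D$ subject to $v=v^{k+1/2}$ on $D^c$; set $I^{k+1}=\{x\in D: (Lv^{k+1}+f)(x)\le\lambda(Mv^{k+1}-v^{k+1})(x)\}$ (intervention regions being understood as subsets of $G_{<0}$), where $\lambda>0$ is a fixed scaling factor, and $\delta^{k+1}=\delta^*(v^{k+1})$. Unique impulse property (UIP). $v\in\mathbb R^G$ has the UIP if for each $x\in\{Mv=v\}$ there is a unique impulse $\delta(x)\in Z(x)$ that realizes the maximum defining $Mv(x)$. Matrix notions. For a real square matrix $A$: row $i$ is WDD (resp.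 SDD) if $|A_{ii}|\ge\sum_{j\ne i}|A_{ij}|$ (resp. $>$); $A$ is WDD (SDD) if all rows are; $A$ is an $L_0$-matrix if its off-diagonal entries are $\le0$ and its diagonal entries are $\ge0$. graph$A$ is the directed graph on the row indices with an edge $(i,j)$ iff $A_{ij}\neq0$; a walk is a nonempty finite sequence of consecutive edges. Assumptions. (A0) For each $\varphi=(I,\delta)\in\Phi$ and $x\in I$ there is a walk in graph$B(\delta)$ from row $x$ to some row $y\in I^c$. (A1) $-L$ is an SDD $L_0$-matrix and, for each $\delta\in Z$, $\operatorname{Id}-B(\delta)$ is a WDD $L_0$-matrix. (A2) $B(\delta)$ has nonnegative diagonal elements for all $\delta\in Z$.
   Formalization: It is additionally assumed that for x ≥ 0 the null impulse leaves the state in place, i.e. row x of B(δ) is the identity row for every δ in Z; otherwise Mv = v can occur at nonnegative grid points and both (i) and (ii) can fail. *)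

theory Defs
  imports "HOL-Analysis.Analysis" "HOL-Library.FuncSet"
begin

text \<open>
  A vector of \<open>\<real>\<^sup>G\<close> is a function \<open>real \<Rightarrow> real\<close> of which only the values on the finite set \<open>G\<close> matter;
  a matrix of \<open>\<real>\<close> indexed by \<open>G \<times> G\<close> is a function \<open>real \<Rightarrow> real \<Rightarrow> real\<close> (row, then column) of which
  only the values on \<open>G \<times> G\<close> matter.  The product of the sets \<open>Z x\<close> is \<open>PiE G Z\<close>, whose members are
  fixed outside \<open>G\<close>, so that it is finite.
\<close>

type_synonym vector = "real \<Rightarrow> real"
type_synonym matrix = "real \<Rightarrow> real \<Rightarrow> real"

definition symmetric_grid :: "real set \<Rightarrow> bool" where
  "symmetric_grid G \<longleftrightarrow>
     (\<exists>(N::nat) (x :: int \<Rightarrow> real).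
        strict_mono_on {- int N..int N} x \<and>
        x 0 = 0 \<and>
        (\<forall>i\<in>{- int N..int N}. x (- i) = - x i) \<and>
        G = x ` {- int N..int N})"

definition neg_points :: "real set \<Rightarrow> real set" where
  "neg_points G = {x \<in> G. x < 0}"

definition sym_op :: "vector \<Rightarrow> vector" where
  "sym_op v = (\<lambda>x. v (- x))"

definition mat_app :: "real set \<Rightarrow> matrix \<Rightarrow> vector \<Rightarrow> vector" where
  "mat_app G A v = (\<lambda>x. \<Sum>y\<in>G. A x y * v y)"

definition id_mat :: matrix where
  "id_mat = (\<lambda>x y. if x = y then 1 else 0)"


subsection \<open>Matrix notions\<close>

definition WDD :: "real set \<Rightarrow> matrix \<Rightarrow> bool" where
  "WDD G A \<longleftrightarrow> (\<forall>i\<in>G. \<bar>A i i\<bar> \<ge> (\<Sum>j\<in>G - {i}. \<bar>A i j\<bar>))"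

definition SDD :: "real set \<Rightarrow> matrix \<Rightarrow> bool" where
  "SDD G A \<longleftrightarrow> (\<forall>i\<in>G. \<bar>A i i\<bar> > (\<Sum>j\<in>G - {i}. \<bar>A i j\<bar>))"

definition L0_matrix :: "real set \<Rightarrow> matrix \<Rightarrow> bool" where
  "L0_matrix G A \<longleftrightarrow>
     (\<forall>i\<in>G. A i i \<ge> 0) \<and> (\<forall>i\<in>G. \<forall>j\<in>G. i \<noteq> j \<longrightarrow> A i j \<le> 0)"

text \<open>Walks are nonempty, so being joined by a walk is membership in \<open>(mat_graph G A)\<^sup>+\<close>.\<close>

definition mat_graph :: "real set \<Rightarrow> matrix \<Rightarrow> (real \<times> real) set" where
  "mat_graph G A = {(i, j). i \<in> G \<and> j \<in> G \<and> A i j \<noteq> 0}"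


subsection \<open>Impulses and the operators \<open>M\<close> and \<open>H\<close>\<close>

text \<open>
  In \<open>g\<close> the argument is the reflected impulse \<open>sym_op \<delta>\<close>.
\<close>

definition impulse_data ::
  "real set \<Rightarrow> (real \<Rightarrow> real set) \<Rightarrow> (vector \<Rightarrow> matrix) \<Rightarrow> (vector \<Rightarrow> vector) \<Rightarrow> (vector \<Rightarrow> vector) \<Rightarrow> bool"
  where
  "impulse_data G Z B c g \<longleftrightarrow>
     (\<forall>x\<in>G. finite (Z x) \<and> Z x \<noteq> {}) \<and>
     (\<forall>x\<in>G. x \<ge> 0 \<longrightarrow> Z x = {0}) \<and>
     (\<forall>\<delta>\<in>PiE G Z. \<forall>x\<in>G. c \<delta> x > 0) \<and>
     (\<forall>\<delta>\<in>PiE G Z. \<forall>\<delta>'\<in>PiE G Z. \<forall>x\<in>G. \<delta> x = \<delta>' x \<longrightarrow>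
        (\<forall>y\<in>G. B \<delta> x y = B \<delta>' x y) \<and> c \<delta> x = c \<delta>' x) \<and>
     (\<forall>\<delta>\<in>PiE G Z. \<forall>\<delta>'\<in>PiE G Z. \<forall>x\<in>G. sym_op \<delta> x = sym_op \<delta>' x \<longrightarrow>
        g (sym_op \<delta>) x = g (sym_op \<delta>') x)"

text \<open>
  At a point \<open>x \<ge> 0\<close> the only impulse is the null one, which means that no intervention takes place:
  the state is not moved, i.e. row \<open>x\<close> of \<open>B \<delta>\<close> is that of the identity.  Without this, \<open>M v = v\<close>
  could hold at nonnegative points, although only negative points count as intervention points.
\<close>

definition null_impulse_on_nonneg ::
  "real set \<Rightarrow> (real \<Rightarrow> real set) \<Rightarrow> (vector \<Rightarrow> matrix) \<Rightarrow> bool" where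
  "null_impulse_on_nonneg G Z B \<longleftrightarrow>
     (\<forall>\<delta>\<in>PiE G Z. \<forall>x\<in>G. x \<ge> 0 \<longrightarrow> (\<forall>y\<in>G. B \<delta> x y = id_mat x y))"

definition gain ::
  "real set \<Rightarrow> (vector \<Rightarrow> matrix) \<Rightarrow> (vector \<Rightarrow> vector) \<Rightarrow> vector \<Rightarrow> vector \<Rightarrow> vector" where
  "gain G B c v \<delta> = (\<lambda>x. mat_app G (B \<delta>) v x - c \<delta> x)"

definition M_op ::
  "real set \<Rightarrow> (real \<Rightarrow> real set) \<Rightarrow> (vector \<Rightarrow> matrix) \<Rightarrow> (vector \<Rightarrow> vector) \<Rightarrow> vector \<Rightarrow> vector" where
  "M_op G Z B c v = (\<lambda>x. Max ((\<lambda>\<delta>. gain G B c v \<delta> x) ` PiE G Z))"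

definition argmax_impulses ::
  "real set \<Rightarrow> (real \<Rightarrow> real set) \<Rightarrow> (vector \<Rightarrow> matrix) \<Rightarrow> (vector \<Rightarrow> vector) \<Rightarrow> vector \<Rightarrow> vector set"
  where
  "argmax_impulses G Z B c v =
     {\<delta> \<in> PiE G Z. \<forall>\<delta>'\<in>PiE G Z. \<forall>x\<in>G. gain G B c v \<delta>' x \<le> gain G B c v \<delta> x}"

definition opt_impulse ::
  "real set \<Rightarrow> (real \<Rightarrow> real set) \<Rightarrow> (vector \<Rightarrow> matrix) \<Rightarrow> (vector \<Rightarrow> vector) \<Rightarrow> vector \<Rightarrow> vector" where
  "opt_impulse G Z B c v = (\<lambda>x\<in>G. Max ((\<lambda>\<delta>. \<delta> x) ` argmax_impulses G Z B c v))"

definition H_imp ::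
  "real set \<Rightarrow> (vector \<Rightarrow> matrix) \<Rightarrow> (vector \<Rightarrow> vector) \<Rightarrow> vector \<Rightarrow> vector \<Rightarrow> vector" where
  "H_imp G B g \<delta> v = (\<lambda>x. sym_op (mat_app G (B \<delta>) (sym_op v)) x + g (sym_op \<delta>) x)"

definition H_op ::
  "real set \<Rightarrow> (real \<Rightarrow> real set) \<Rightarrow> (vector \<Rightarrow> matrix) \<Rightarrow> (vector \<Rightarrow> vector) \<Rightarrow> (vector \<Rightarrow> vector) \<Rightarrow>
    vector \<Rightarrow> vector" where
  "H_op G Z B c g v = H_imp G B g (opt_impulse G Z B c v) v"

definition unique_impulse_property ::
  "real set \<Rightarrow> (real \<Rightarrow> real set) \<Rightarrow> (vector \<Rightarrow> matrix) \<Rightarrow> (vector \<Rightarrow> vector) \<Rightarrow> vector \<Rightarrow> bool" where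
  "unique_impulse_property G Z B c v \<longleftrightarrow>
     (\<forall>x\<in>{x \<in> G. M_op G Z B c v x = v x}.
        \<exists>!z. z \<in> Z x \<and> (\<exists>\<delta>\<in>PiE G Z. \<delta> x = z \<and> gain G B c v \<delta> x = M_op G Z B c v x))"


subsection \<open>Assumptions\<close>

definition strategies :: "real set \<Rightarrow> (real \<Rightarrow> real set) \<Rightarrow> (real set \<times> vector) set" where
  "strategies G Z = {(I, \<delta>). I \<subseteq> neg_points G \<and> \<delta> \<in> PiE G Z}"

definition assumption_A0 ::
  "real set \<Rightarrow> (real \<Rightarrow> real set) \<Rightarrow> (vector \<Rightarrow> matrix) \<Rightarrow> bool" where
  "assumption_A0 G Z B \<longleftrightarrow>
     (\<forall>(I, \<delta>)\<in>strategies G Z. \<forall>x\<in>I. \<exists>y\<in>G - I. (x, y) \<in> (mat_graph G (B \<delta>))\<^sup>+)"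

definition assumption_A1 ::
  "real set \<Rightarrow> (real \<Rightarrow> real set) \<Rightarrow> matrix \<Rightarrow> (vector \<Rightarrow> matrix) \<Rightarrow> bool" where
  "assumption_A1 G Z L B \<longleftrightarrow>
     SDD G (\<lambda>x y. - L x y) \<and> L0_matrix G (\<lambda>x y. - L x y) \<and>
     (\<forall>\<delta>\<in>PiE G Z. WDD G (\<lambda>x y. id_mat x y - B \<delta> x y) \<and>
                    L0_matrix G (\<lambda>x y. id_mat x y - B \<delta> x y))"

definition assumption_A2 ::
  "real set \<Rightarrow> (real \<Rightarrow> real set) \<Rightarrow> (vector \<Rightarrow> matrix) \<Rightarrow> bool" where
  "assumption_A2 G Z B \<longleftrightarrow> (\<forall>\<delta>\<in>PiE G Z. \<forall>x\<in>G. B \<delta> x x \<ge> 0)"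


subsection \<open>The algorithm\<close>

text \<open>
  \<open>vh k\<close> is the half-step iterate between \<open>v k\<close> and \<open>v (Suc k)\<close>, and \<open>lam\<close> is the scaling factor.
  The free region of step \<open>k\<close> is \<open>G - uminus ` I k\<close>.
\<close>

definition algorithm_run ::
  "real set \<Rightarrow> (real \<Rightarrow> real set) \<Rightarrow> matrix \<Rightarrow> vector \<Rightarrow>
   (vector \<Rightarrow> matrix) \<Rightarrow> (vector \<Rightarrow> vector) \<Rightarrow> (vector \<Rightarrow> vector) \<Rightarrow> real \<Rightarrow>
   (nat \<Rightarrow> vector) \<Rightarrow> (nat \<Rightarrow> vector) \<Rightarrow> (nat \<Rightarrow> real set) \<Rightarrow> (nat \<Rightarrow> vector) \<Rightarrow> bool" where
  "algorithm_run G Z L f B c g lam v vh I \<delta> \<longleftrightarrow>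
     I 0 = {x \<in> G. mat_app G L (v 0) x + f x \<le> M_op G Z B c (v 0) x - v 0 x} \<inter> neg_points G \<and>
     \<delta> 0 = opt_impulse G Z B c (v 0) \<and>
     (\<forall>k. let D = G - uminus ` I k in
        (\<forall>x\<in>uminus ` I k. vh k x = H_imp G B g (\<delta> k) (v k) x) \<and>
        (\<forall>x\<in>D. vh k x = v k x) \<and>
        (\<forall>x\<in>D. max (mat_app G L (v (Suc k)) x + f x) (M_op G Z B c (v (Suc k)) x - v (Suc k) x) = 0) \<and>
        (\<forall>x\<in>G - D. v (Suc k) x = vh k x) \<and>
        I (Suc k) = {x \<in> D. mat_app G L (v (Suc k)) x + f x
                              \<le> lam * (M_op G Z B c (v (Suc k)) x - v (Suc k) x)} \<inter> neg_points G \<and>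
        \<delta> (Suc k) = opt_impulse G Z B c (v (Suc k)))"


subsection \<open>The discrete system of QVIs\<close>

definition solves_QVI_system ::
  "real set \<Rightarrow> (real \<Rightarrow> real set) \<Rightarrow> matrix \<Rightarrow> vector \<Rightarrow>
   (vector \<Rightarrow> matrix) \<Rightarrow> (vector \<Rightarrow> vector) \<Rightarrow> (vector \<Rightarrow> vector) \<Rightarrow> vector \<Rightarrow> bool" where
  "solves_QVI_system G Z L f B c g v \<longleftrightarrow>
     (\<forall>x\<in>uminus ` {x \<in> G. M_op G Z B c v x - v x = 0}. H_op G Z B c g v x - v x = 0) \<and>
     (\<forall>x\<in>uminus ` {x \<in> G. M_op G Z B c v x - v x < 0}.
        max (mat_app G L v x + f x) (M_op G Z B c v x - v x) = 0)"

definition border_region ::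
  "real set \<Rightarrow> (real \<Rightarrow> real set) \<Rightarrow> matrix \<Rightarrow> vector \<Rightarrow>
   (vector \<Rightarrow> matrix) \<Rightarrow> (vector \<Rightarrow> vector) \<Rightarrow> vector \<Rightarrow> real set" where
  "border_region G Z L f B c v =
     {x \<in> G. mat_app G L v x + f x = M_op G Z B c v x - v x} \<inter> neg_points G"

end

theory Submission
  imports Defs
begin

text \<open>
  The proof passes to the limit in the two equations that define a step of the algorithm.  The only
  discontinuous ingredients are the intervention regions \<open>I k\<close> and the impulses \<open>\<delta> k\<close>; everything
  else (\<open>L\<close>, \<open>M\<close>, and \<open>H_imp\<close> at a fixed impulse) is continuous on the finite-dimensional
  space of vectors.

  From step \<open>1\<close> on, \<open>v k\<close> satisfies the obstacle equation at all negative points, and therefore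
  \<open>I k\<close> is exactly the set of negative points with \<open>M (v k) = v k\<close>
  (\<open>intervention_iff_contact\<close>).  At a point \<open>x\<close> one of two things holds for infinitely many \<open>k\<close>.
  If \<open>x \<notin> I k\<close> infinitely often, the limit \<open>w\<close> inherits the obstacle equation at \<open>- x\<close>
  (\<open>limit_obstacle_equation\<close>).  If \<open>x \<in> I k\<close> infinitely often, and \<open>\<delta> k x\<close> agrees there with the
  impulse that is optimal for \<open>w\<close>, then \<open>w\<close> inherits \<open>H w = w\<close> at \<open>- x\<close>
  (\<open>limit_response_equation\<close>).

  At points with \<open>M w < w\<close> the first case occurs by continuity of \<open>M\<close>, so the second equation of the
  system always holds, and only the points with \<open>M w = w\<close> matter
  (\<open>solves_system_if_response\<close>).  Under exact convergence \<open>I k\<close> and \<open>\<delta> k\<close> are eventually those of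
  \<open>w\<close>.  Otherwise, the unique impulse property makes \<open>\<delta> k x\<close> eventually optimal for \<open>w\<close>
  (\<open>impulses_stabilise\<close>), because a strictly suboptimal impulse remains so for nearby vectors; this
  settles the contact points that lie in \<open>I k\<close> infinitely often.  A contact point \<open>x\<close> that eventually
  stays outside \<open>I k\<close> satisfies \<open>L w + f = 0\<close> in the limit and so belongs to the border region.
  Its reflection \<open>- x\<close> is positive, so \<open>M w < w\<close> there and the obstacle equation says
  \<open>L w + f = 0\<close> at \<open>- x\<close>; the hypothesis on the border region turns this into \<open>H w = w\<close>.
\<close>

section \<open>Impulses and maximal gains\<close>

lemma symmetric_grid_finite: "symmetric_grid G \<Longrightarrow> finite G"
  unfolding symmetric_grid_def by force

lemma symmetric_grid_uminus: "symmetric_grid G \<Longrightarrow> x \<in> G \<Longrightarrow> - x \<in> G"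
proof -
  assume "symmetric_grid G" "x \<in> G"
  then obtain N :: nat and p i where
    p: "\<forall>i\<in>{- int N..int N}. p (- i) = - p i" "G = p ` {- int N..int N}"
    and i: "i \<in> {- int N..int N}" "x = p i"
    unfolding symmetric_grid_def by blast
  then have "- x = p (- i)" "- i \<in> {- int N..int N}" by auto
  then show "- x \<in> G" using p(2) by blast
qed

lemma tendsto_mat_app:
  assumes "\<forall>y\<in>G. (\<lambda>k. u k y) \<longlonglongrightarrow> w y"
  shows "(\<lambda>k. mat_app G A (u k) x) \<longlonglongrightarrow> mat_app G A w x"
  unfolding mat_app_def by (intro tendsto_intros) (use assms in auto)

lemma tendsto_Max_image:
  fixes h :: "nat \<Rightarrow> 'a \<Rightarrow> real"
  assumes "finite S" "S \<noteq> {}" "\<And>s. s \<in> S \<Longrightarrow> (\<lambda>k. h k s) \<longlonglongrightarrow> h' s"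
  shows "(\<lambda>k. Max (h k ` S)) \<longlonglongrightarrow> Max (h' ` S)"
  using assms
proof (induction S rule: finite_ne_induct)
  case (insert s S)
  then show ?case by (simp add: tendsto_max)
qed simp

lemma tendsto_frequently_zero:
  fixes h :: "nat \<Rightarrow> real"
  assumes "h \<longlonglongrightarrow> l" "\<exists>\<^sub>F k in sequentially. h k = 0"
  shows "l = 0"
  using assms tendsto_imp_eventually_ne[OF assms(1), of 0] by (auto simp: frequently_def)

locale impulse_setting =
  fixes G :: "real set" and Z :: "real \<Rightarrow> real set"
    and B :: "vector \<Rightarrow> matrix" and c g :: "vector \<Rightarrow> vector"
  assumes grid: "symmetric_grid G"
    and data: "impulse_data G Z B c g"
    and null: "null_impulse_on_nonneg G Z B"
begin

abbreviation "M \<equiv> M_op G Z B c"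
abbreviation "opt \<equiv> opt_impulse G Z B c"
abbreviation "H \<equiv> H_op G Z B c g"
abbreviation "gn \<equiv> gain G B c"

lemma finite_grid: "finite G"
  using grid by (rule symmetric_grid_finite)

lemma uminus_grid: "x \<in> G \<Longrightarrow> - x \<in> G"
  using grid by (rule symmetric_grid_uminus)

lemma finite_impulses: "finite (PiE G Z)"
  using data finite_grid unfolding impulse_data_def by (intro finite_PiE) auto

lemma impulses_nonempty: "PiE G Z \<noteq> {}"
  using data unfolding impulse_data_def by (auto simp: PiE_eq_empty_iff)

lemma gain_row:
  assumes "\<delta> \<in> PiE G Z" "\<delta>' \<in> PiE G Z" "x \<in> G" "\<delta> x = \<delta>' x"
  shows "gn u \<delta> x = gn u \<delta>' x"
proof -
  have "(\<forall>y\<in>G. B \<delta> x y = B \<delta>' x y) \<and> c \<delta> x = c \<delta>' x"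
    using data assms unfolding impulse_data_def by blast
  then show ?thesis
    by (auto simp: gain_def mat_app_def intro!: sum.cong)
qed

lemma gain_le_M: "\<delta> \<in> PiE G Z \<Longrightarrow> gn u \<delta> x \<le> M u x"
  unfolding M_op_def using finite_impulses by auto

lemma M_attained: "\<exists>\<delta>\<in>PiE G Z. gn u \<delta> x = M u x"
proof -
  have "M u x \<in> (\<lambda>\<delta>. gn u \<delta> x) ` PiE G Z"
    unfolding M_op_def using finite_impulses impulses_nonempty by (intro Max_in) auto
  then show ?thesis by auto
qed

text \<open>
  Row decoupling allows maximizers chosen separately for each grid point to be glued together; this
  is why a single impulse can maximize the gain at all grid points.
\<close>

lemma argmax_nonempty: "argmax_impulses G Z B c u \<noteq> {}"
proof -
  obtain m where m: "\<And>x. m x \<in> PiE G Z" "\<And>x. gn u (m x) x = M u x"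
    using M_attained[of u] by metis
  define \<delta> where "\<delta> = (\<lambda>x\<in>G. m x x)"
  have mem: "\<delta> \<in> PiE G Z"
    using m(1) by (auto simp: \<delta>_def)
  have "gn u \<delta> x = M u x" if "x \<in> G" for x
    using gain_row[OF mem m(1)[of x] that] m(2)[of x] that by (simp add: \<delta>_def)
  then have "\<delta> \<in> argmax_impulses G Z B c u"
    using mem gain_le_M by (auto simp: argmax_impulses_def)
  then show ?thesis by blast
qed

lemma argmax_gain:
  assumes "\<delta> \<in> argmax_impulses G Z B c u" "x \<in> G"
  shows "gn u \<delta> x = M u x"
proof -
  obtain \<delta>' where "\<delta>' \<in> PiE G Z" "gn u \<delta>' x = M u x"
    using M_attained by blast
  then have "M u x \<le> gn u \<delta> x"
    using assms unfolding argmax_impulses_def by force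
  then show ?thesis
    using assms gain_le_M[of \<delta> u x] by (auto simp: argmax_impulses_def)
qed

lemma opt_row:
  assumes "x \<in> G"
  shows "\<exists>\<delta>\<in>argmax_impulses G Z B c u. opt u x = \<delta> x"
proof -
  have "finite (argmax_impulses G Z B c u)"
    using finite_impulses by (simp add: argmax_impulses_def)
  then have "Max ((\<lambda>\<delta>. \<delta> x) ` argmax_impulses G Z B c u) \<in> (\<lambda>\<delta>. \<delta> x) ` argmax_impulses G Z B c u"
    using argmax_nonempty by (intro Max_in) auto
  then show ?thesis
    using assms by (auto simp: opt_impulse_def)
qed

lemma opt_mem: "opt u \<in> PiE G Z"
proof (rule PiE_I)
  fix x assume "x \<in> G"
  then show "opt u x \<in> Z x"
    using opt_row[of x u] by (auto simp: argmax_impulses_def)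
qed (simp add: opt_impulse_def)

lemma opt_gain:
  assumes "x \<in> G"
  shows "gn u (opt u) x = M u x"
proof -
  obtain \<delta> where \<delta>: "\<delta> \<in> argmax_impulses G Z B c u" "opt u x = \<delta> x"
    using opt_row[OF assms] by blast
  then have "\<delta> \<in> PiE G Z" by (simp add: argmax_impulses_def)
  from gain_row[OF opt_mem this assms \<delta>(2), of u] show ?thesis
    using argmax_gain[OF \<delta>(1) assms] by simp
qed

text \<open>
  At a nonnegative point the null impulse leaves the state where it is and still costs \<open>c > 0\<close>.
  Contact \<open>M u = u\<close> is therefore confined to the negative points, and no point is in contact
  together with its reflection.
\<close>

lemma M_less_nonneg:
  assumes "x \<in> G" "x \<ge> 0"
  shows "M u x < u x"
proof -
  obtain \<delta> where \<delta>: "\<delta> \<in> PiE G Z" "gn u \<delta> x = M u x"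
    using M_attained by blast
  have row: "\<forall>y\<in>G. B \<delta> x y = id_mat x y"
    using null \<delta>(1) assms unfolding null_impulse_on_nonneg_def by blast
  have "mat_app G (B \<delta>) u x = (\<Sum>y\<in>G. if x = y then u y else 0)"
    unfolding mat_app_def using row by (intro sum.cong) (auto simp: id_mat_def)
  also have "\<dots> = u x"
    using finite_grid assms by simp
  finally have "mat_app G (B \<delta>) u x = u x" .
  moreover have "c \<delta> x > 0"
    using data \<delta>(1) assms unfolding impulse_data_def by blast
  ultimately show ?thesis
    using \<delta>(2) by (simp add: gain_def)
qed

text \<open>
  The reflection in \<open>H_imp\<close> makes its value at \<open>- x\<close> depend on the impulse at \<open>x\<close> only, so it is
  enough to control \<open>\<delta> k\<close> at the single point \<open>x\<close>.
\<close>

lemma H_imp_row: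
  assumes "\<delta> \<in> PiE G Z" "\<delta>' \<in> PiE G Z" "x \<in> G" "\<delta> x = \<delta>' x"
  shows "H_imp G B g \<delta> u (- x) = H_imp G B g \<delta>' u (- x)"
proof -
  have "\<forall>y\<in>G. B \<delta> x y = B \<delta>' x y"
    using data assms unfolding impulse_data_def by blast
  then have "mat_app G (B \<delta>) (sym_op u) x = mat_app G (B \<delta>') (sym_op u) x"
    by (simp add: mat_app_def)
  moreover have "g (sym_op \<delta>) (- x) = g (sym_op \<delta>') (- x)"
  proof -
    have "\<forall>\<delta>\<in>PiE G Z. \<forall>\<delta>'\<in>PiE G Z. \<forall>x\<in>G. sym_op \<delta> x = sym_op \<delta>' x \<longrightarrow>
        g (sym_op \<delta>) x = g (sym_op \<delta>') x"
      using data unfolding impulse_data_def by (elim conjE)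
    from this[rule_format, OF assms(1,2) uminus_grid[OF assms(3)]] show ?thesis
      using assms(4) by (simp only: sym_op_def minus_minus)
  qed
  ultimately show ?thesis
    by (simp add: H_imp_def sym_op_def)
qed

lemma opt_cong:
  assumes "\<forall>y\<in>G. u y = w y"
  shows "opt u = opt w"
proof -
  have "gn u = gn w"
    using assms by (auto simp: gain_def mat_app_def fun_eq_iff)
  then show ?thesis
    by (simp add: opt_impulse_def argmax_impulses_def)
qed

lemma tendsto_gain:
  assumes "\<forall>y\<in>G. (\<lambda>k. u k y) \<longlonglongrightarrow> w y"
  shows "(\<lambda>k. gn (u k) \<delta> x) \<longlonglongrightarrow> gn w \<delta> x"
  unfolding gain_def by (intro tendsto_intros tendsto_mat_app assms)

lemma tendsto_M:
  assumes "\<forall>y\<in>G. (\<lambda>k. u k y) \<longlonglongrightarrow> w y"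
  shows "(\<lambda>k. M (u k) x) \<longlonglongrightarrow> M w x"
  unfolding M_op_def
  using finite_impulses impulses_nonempty tendsto_gain[OF assms] by (intro tendsto_Max_image) auto

lemma tendsto_H_imp:
  assumes "\<forall>y\<in>G. (\<lambda>k. u k y) \<longlonglongrightarrow> w y"
  shows "(\<lambda>k. H_imp G B g \<delta> (u k) x) \<longlonglongrightarrow> H_imp G B g \<delta> w x"
proof -
  have "\<forall>y\<in>G. (\<lambda>k. sym_op (u k) y) \<longlonglongrightarrow> sym_op w y"
    using assms uminus_grid by (simp add: sym_op_def)
  from tendsto_mat_app[OF this] show ?thesis
    unfolding H_imp_def by (intro tendsto_intros) (simp add: sym_op_def)
qed

text \<open>
  An impulse that is strictly suboptimal for \<open>w\<close> is so for all vectors close to \<open>w\<close>.  As there are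
  only finitely many impulses, those chosen along the sequence are eventually maximizers for \<open>w\<close>,
  and by uniqueness they take the value chosen for \<open>w\<close>.
\<close>

lemma impulses_stabilise:
  assumes conv: "\<forall>y\<in>G. (\<lambda>k. u k y) \<longlonglongrightarrow> w y"
    and uip: "unique_impulse_property G Z B c w"
    and x: "x \<in> G" "M w x = w x"
  shows "\<forall>\<^sub>F k in sequentially. opt (u k) x = opt w x"
proof -
  have ev: "\<forall>\<^sub>F k in sequentially. gn (u k) \<delta> x < M (u k) x"
    if "gn w \<delta> x < M w x" for \<delta>
    using order_tendstoD(1)[OF tendsto_diff[OF tendsto_M[OF conv] tendsto_gain[OF conv]], of 0 x \<delta> x] that
    by simp
  have "\<forall>\<^sub>F k in sequentially. \<forall>\<delta>\<in>PiE G Z. gn w \<delta> x < M w x \<longrightarrow> gn (u k) \<delta> x < M (u k) x"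
    using finite_impulses
  proof (rule eventually_ball_finite, intro ballI)
    fix \<delta> assume "\<delta> \<in> PiE G Z"
    show "\<forall>\<^sub>F k in sequentially. gn w \<delta> x < M w x \<longrightarrow> gn (u k) \<delta> x < M (u k) x"
      using ev[of \<delta>] by (cases "gn w \<delta> x < M w x") simp_all
  qed
  then show ?thesis
  proof (rule eventually_mono)
    fix k assume sub: "\<forall>\<delta>\<in>PiE G Z. gn w \<delta> x < M w x \<longrightarrow> gn (u k) \<delta> x < M (u k) x"
    have "gn w (opt (u k)) x = M w x"
      using sub opt_mem[of "u k"] opt_gain[OF x(1), of "u k"] gain_le_M[OF opt_mem, of w "u k" x]
      by force
    then show "opt (u k) x = opt w x"
      using uip x opt_mem[of "u k"] opt_mem[of w] opt_gain[OF x(1), of w]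
      unfolding unique_impulse_property_def by (blast dest: PiE_mem)
  qed
qed

end


section \<open>Passing to the limit in the algorithm\<close>

locale convergent_run = impulse_setting +
  fixes L :: matrix and f :: vector and lam :: real
    and v vh :: "nat \<Rightarrow> vector" and I :: "nat \<Rightarrow> real set" and \<delta> :: "nat \<Rightarrow> vector"
    and w :: vector
  assumes scale: "lam > 0"
    and run: "algorithm_run G Z L f B c g lam v vh I \<delta>"
    and lim: "\<forall>x\<in>G. (\<lambda>k. v k x) \<longlonglongrightarrow> w x"
begin

abbreviation "Lf u x \<equiv> mat_app G L u x + f x"

lemma impulse_eq_opt: "\<delta> k = opt (v k)"
  using run unfolding algorithm_run_def Let_def by (cases k) auto

lemma intervention_subset: "I k \<subseteq> neg_points G"
  using run unfolding algorithm_run_def Let_def by (cases k) blast+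

lemma response_step:
  assumes "x \<in> I k"
  shows "v (Suc k) (- x) = H_imp G B g (\<delta> k) (v k) (- x)"
proof -
  have "- x \<in> uminus ` I k" "- x \<in> G"
    using assms intervention_subset[of k] uminus_grid by (auto simp: neg_points_def)
  then have "- x \<in> G - (G - uminus ` I k)" by blast
  then show ?thesis
    using run \<open>- x \<in> uminus ` I k\<close> unfolding algorithm_run_def Let_def by metis
qed

lemma obstacle_step:
  assumes "x \<in> G" "- x \<notin> I k"
  shows "max (Lf (v (Suc k)) x) (M (v (Suc k)) x - v (Suc k) x) = 0"
proof -
  have "x \<notin> uminus ` I k" using assms(2) by auto
  then show ?thesis
    using run assms(1) unfolding algorithm_run_def Let_def by blast
qed

text \<open>
  Negative points are never reflections of intervention points, so the obstacle equation is imposed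
  on all of them at every step: one of \<open>L v + f\<close> and \<open>M v - v\<close> vanishes while the other is nonpositive.
  This makes the comparison with any positive multiple of \<open>M v - v\<close> equivalent to contact.
\<close>

lemma intervention_iff_contact:
  "x \<in> I (Suc k) \<longleftrightarrow> x \<in> neg_points G \<and> M (v (Suc k)) x = v (Suc k) x"
proof -
  have mem: "x \<in> I (Suc k) \<longleftrightarrow>
      x \<in> neg_points G - uminus ` I k \<and> Lf (v (Suc k)) x \<le> lam * (M (v (Suc k)) x - v (Suc k) x)"
    using run unfolding algorithm_run_def Let_def by (auto simp: neg_points_def)
  have "- x \<notin> I k" "x \<notin> uminus ` I k" if "x \<in> neg_points G"
    using that intervention_subset[of k] by (auto simp: neg_points_def)
  moreover have "Lf (v (Suc k)) x \<le> lam * (M (v (Suc k)) x - v (Suc k) x)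
      \<longleftrightarrow> M (v (Suc k)) x = v (Suc k) x" if "x \<in> G" "- x \<notin> I k"
    using obstacle_step[OF that] mult_pos_neg[OF scale, of "M (v (Suc k)) x - v (Suc k) x"]
    by (auto simp: max_def split: if_splits)
  ultimately show ?thesis
    unfolding mem by (auto simp: neg_points_def)
qed

lemma tendsto_Lf: "(\<lambda>k. Lf (v k) x) \<longlonglongrightarrow> Lf w x"
  by (intro tendsto_intros tendsto_mat_app lim)

lemma tendsto_contact: "x \<in> G \<Longrightarrow> (\<lambda>k. M (v k) x - v k x) \<longlonglongrightarrow> M w x - w x"
  by (intro tendsto_diff tendsto_M lim) (use lim in auto)

text \<open>
  In the next two lemmas infinitely many favourable steps suffice, because the whole sequence
  converges.  The regions \<open>I k\<close> may thus oscillate between the two cases.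
\<close>

lemma limit_obstacle_equation:
  assumes "x \<in> G" "\<exists>\<^sub>F k in sequentially. - x \<notin> I k"
  shows "max (Lf w x) (M w x - w x) = 0"
proof (rule tendsto_frequently_zero)
  show "(\<lambda>k. max (Lf (v (Suc k)) x) (M (v (Suc k)) x - v (Suc k) x))
      \<longlonglongrightarrow> max (Lf w x) (M w x - w x)"
    using tendsto_max[OF tendsto_Lf tendsto_contact[OF assms(1)], THEN LIMSEQ_Suc] .
  show "\<exists>\<^sub>F k in sequentially. max (Lf (v (Suc k)) x) (M (v (Suc k)) x - v (Suc k) x) = 0"
    using assms(2) by (rule frequently_elim1) (rule obstacle_step[OF assms(1)])
qed

lemma limit_response_equation:
  assumes "x \<in> G" "\<exists>\<^sub>F k in sequentially. x \<in> I k \<and> \<delta> k x = opt w x"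
  shows "H w (- x) = w (- x)"
proof -
  have "w (- x) - H w (- x) = 0"
  proof (rule tendsto_frequently_zero)
    have "(\<lambda>k. v k (- x)) \<longlonglongrightarrow> w (- x)"
      using lim uminus_grid[OF assms(1)] by blast
    then show "(\<lambda>k. v (Suc k) (- x) - H_imp G B g (opt w) (v k) (- x)) \<longlonglongrightarrow> w (- x) - H w (- x)"
      unfolding H_op_def by (intro tendsto_diff LIMSEQ_Suc tendsto_H_imp lim)
    show "\<exists>\<^sub>F k in sequentially. v (Suc k) (- x) - H_imp G B g (opt w) (v k) (- x) = 0"
      using assms(2)
    proof (rule frequently_elim1)
      fix k assume k: "x \<in> I k \<and> \<delta> k x = opt w x"
      have "H_imp G B g (\<delta> k) (v k) (- x) = H_imp G B g (opt w) (v k) (- x)"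
        using k opt_mem assms(1) by (intro H_imp_row) (auto simp: impulse_eq_opt)
      then show "v (Suc k) (- x) - H_imp G B g (opt w) (v k) (- x) = 0"
        using response_step[of x k] k by simp
    qed
  qed
  then show ?thesis by simp
qed

lemma eventually_free:
  assumes "x \<in> G" "M w x < w x"
  shows "\<forall>\<^sub>F k in sequentially. x \<notin> I k"
proof -
  have "(\<lambda>k. M (v (Suc k)) x - v (Suc k) x) \<longlonglongrightarrow> M w x - w x"
    by (rule LIMSEQ_Suc[OF tendsto_contact[OF assms(1)]])
  moreover have "M w x - w x < 0"
    using assms(2) by linarith
  ultimately have "\<forall>\<^sub>F k in sequentially. M (v (Suc k)) x - v (Suc k) x < 0"
    by (rule order_tendstoD(2))
  then have "\<forall>\<^sub>F k in sequentially. x \<notin> I (Suc k)"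
    by (rule eventually_mono) (auto simp: intervention_iff_contact)
  then show ?thesis
    by (simp only: eventually_sequentially_Suc[of "\<lambda>k. x \<notin> I k"])
qed

lemma limit_contact_negative: "x \<in> G \<Longrightarrow> M w x = w x \<Longrightarrow> x \<in> neg_points G"
  using M_less_nonneg[of x w] by (force simp: neg_points_def)


section \<open>The limit solves the system\<close>

text \<open>
  At the reflection of a point with \<open>M w < w\<close> the obstacle equation is inherited from the run,
  since such a point is eventually outside \<open>I k\<close>.  What has to be ruled out in the two cases below is
  that the equation \<open>H w = w\<close> fails opposite a contact point.
\<close>

lemma solves_system_if_response:
  assumes "\<And>x. x \<in> neg_points G \<Longrightarrow> M w x = w x \<Longrightarrow> H w (- x) = w (- x)"
  shows "solves_QVI_system G Z L f B c g w"
  unfolding solves_QVI_system_def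
proof (intro conjI ballI)
  fix y assume "y \<in> uminus ` {x \<in> G. M w x - w x = 0}"
  then show "H w y - w y = 0"
    using assms limit_contact_negative by auto
next
  fix y assume "y \<in> uminus ` {x \<in> G. M w x - w x < 0}"
  then have y: "y \<in> G" "- y \<in> G" "M w (- y) < w (- y)"
    using uminus_grid by auto
  then show "max (Lf w y) (M w y - w y) = 0"
    using eventually_free[of "- y"] eventually_frequently[OF sequentially_bot]
    by (intro limit_obstacle_equation) auto
qed

lemma solves_system_if_exact:
  assumes "\<forall>k\<ge>K. \<forall>x\<in>G. v k x = w x"
  shows "solves_QVI_system G Z L f B c g w"
proof (rule solves_system_if_response)
  fix x assume x: "x \<in> neg_points G" "M w x = w x"
  then have xG: "x \<in> G" by (simp add: neg_points_def)
  have "x \<in> I k \<and> \<delta> k x = opt w x" if gt: "k > K" for k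
  proof -
    obtain j where j: "k = Suc j" using gt by (cases k) auto
    have eq: "\<forall>y\<in>G. v k y = w y" using assms gt by simp
    then have "M (v k) x = M w x"
      using opt_cong[OF eq] opt_gain[OF xG, of "v k"] opt_gain[OF xG, of w]
      by (simp add: gain_def mat_app_def)
    then show ?thesis
      using x xG eq opt_cong[OF eq] by (simp add: j intervention_iff_contact impulse_eq_opt)
  qed
  then have "\<forall>\<^sub>F k in sequentially. x \<in> I k \<and> \<delta> k x = opt w x"
    using eventually_gt_at_top[of K] by (rule eventually_mono[rotated])
  then show "H w (- x) = w (- x)"
    using xG eventually_frequently[OF sequentially_bot] by (intro limit_response_equation) auto
qed

lemma solves_system_if_unique_impulse:
  assumes uip: "unique_impulse_property G Z B c w"
    and border: "\<forall>x\<in>uminus ` border_region G Z L f B c w. Lf w x = H w x - w x"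
  shows "solves_QVI_system G Z L f B c g w"
proof (rule solves_system_if_response)
  fix x assume x: "x \<in> neg_points G" "M w x = w x"
  then have xG: "x \<in> G" and neg: "x < 0" by (auto simp: neg_points_def)
  have "\<forall>\<^sub>F k in sequentially. \<delta> k x = opt w x"
    unfolding impulse_eq_opt using lim uip xG x(2) by (rule impulses_stabilise)
  then have "\<exists>\<^sub>F k in sequentially. x \<in> I k \<and> \<delta> k x = opt w x"
    if "\<exists>\<^sub>F k in sequentially. x \<in> I k"
    using that by (intro frequently_eventually_frequently)
  then have response: "H w (- x) = w (- x)" if "\<exists>\<^sub>F k in sequentially. x \<in> I k"
    using that xG by (intro limit_response_equation) auto
  show "H w (- x) = w (- x)"
  proof (cases "\<exists>\<^sub>F k in sequentially. x \<in> I k")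
    case False
    then have out: "\<forall>\<^sub>F k in sequentially. x \<notin> I k"
      by (simp add: not_frequently)
    \<comment> \<open>Without contact the obstacle equation at \<open>x\<close> along the sequence reads \<open>L v + f = 0\<close>; in the
        limit \<open>M w = w\<close> also holds at \<open>x\<close>, which is thus a border point.\<close>
    have "Lf w x = 0"
    proof (rule tendsto_frequently_zero)
      show "(\<lambda>k. Lf (v (Suc k)) x) \<longlonglongrightarrow> Lf w x"
        by (rule LIMSEQ_Suc[OF tendsto_Lf])
      have "\<forall>\<^sub>F k in sequentially. x \<notin> I (Suc k)"
        using out by (simp only: eventually_sequentially_Suc[of "\<lambda>k. x \<notin> I k"])
      then have "\<forall>\<^sub>F k in sequentially. Lf (v (Suc k)) x = 0"
      proof (rule eventually_mono)
        fix k assume "x \<notin> I (Suc k)"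
        then have "M (v (Suc k)) x \<noteq> v (Suc k) x"
          using x(1) by (simp add: intervention_iff_contact)
        moreover have "- x \<notin> I k"
          using neg intervention_subset[of k] by (auto simp: neg_points_def)
        ultimately show "Lf (v (Suc k)) x = 0"
          using obstacle_step[OF xG, of k] by (auto simp: max_def split: if_splits)
      qed
      then show "\<exists>\<^sub>F k in sequentially. Lf (v (Suc k)) x = 0"
        by (rule eventually_frequently[OF sequentially_bot])
    qed
    then have "x \<in> border_region G Z L f B c w"
      using x xG by (simp add: border_region_def)
    then have "Lf w (- x) = H w (- x) - w (- x)"
      using border by blast
    moreover have "max (Lf w (- x)) (M w (- x) - w (- x)) = 0"
      using out uminus_grid[OF xG] eventually_frequently[OF sequentially_bot]
      by (intro limit_obstacle_equation) auto
    moreover have "M w (- x) < w (- x)"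
      using uminus_grid[OF xG] neg by (intro M_less_nonneg) auto
    ultimately show ?thesis
      by (auto simp: max_def split: if_splits)
  qed (rule response)
qed

end

theorem corollary2p5p3:
  fixes G :: "real set"
    and Z :: "real \<Rightarrow> real set"
    and L :: matrix and f :: vector
    and B :: "vector \<Rightarrow> matrix"
    and c g :: "vector \<Rightarrow> vector"
    and lam :: real
    and v vh :: "nat \<Rightarrow> vector" and I :: "nat \<Rightarrow> real set" and \<delta> :: "nat \<Rightarrow> vector"
    and w :: vector
  assumes grid: "symmetric_grid G"
    and data: "impulse_data G Z B c g"
    and null: "null_impulse_on_nonneg G Z B"
    and A0: "assumption_A0 G Z B"
    and A1: "assumption_A1 G Z L B"
    and A2: "assumption_A2 G Z B"
    and scale: "lam > 0"
    and run: "algorithm_run G Z L f B c g lam v vh I \<delta>"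
    and lim: "\<forall>x\<in>G. (\<lambda>k. v k x) \<longlonglongrightarrow> w x"
  shows "((\<exists>K. \<forall>k\<ge>K. \<forall>x\<in>G. v k x = w x) \<longrightarrow> solves_QVI_system G Z L f B c g w) \<and>
         (unique_impulse_property G Z B c w \<and>
          (\<forall>x\<in>uminus ` border_region G Z L f B c w.
             mat_app G L w x + f x = H_op G Z B c g w x - w x) \<longrightarrow>
          solves_QVI_system G Z L f B c g w)"
proof -
  interpret convergent_run G Z B c g L f lam v vh I \<delta> w
    using grid data null scale run lim by unfold_locales
  show ?thesis
    using solves_system_if_exact solves_system_if_unique_impulse by blast
qed

end
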